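(* Let $\lambda>0$, $\eta\in\mathbb{R}$, $b=\lambda+i\eta$, and let $n\ge 4$. Let $x_{n,1}^{(\eta,\lambda)}<\cdots<x_{n,n}^{(\eta,\lambda)}$ be the zeros of the complementary Romanovski-Routh polynomial $\mathcal{P}_n(b;x)$. Then $$\frac{\eta[n^2+2\lambda+n(\lambda-1)]-(n-1)\sqrt{\Delta_n}}{\lambda[2(n-1)+(n+2)\lambda]}<x_{n,1}^{(\eta,\lambda)}<x_{n,n}^{(\eta,\lambda)}<\frac{\eta[n^2+2\lambda+n(\lambda-1)]+(n-1)\sqrt{\Delta_n}}{\lambda[2(n-1)+(n+2)\lambda]},$$ where $$\Delta_n=[\eta^2+\lambda(\lambda+2)]n^2+2\lambda(\eta^2+\lambda^2+2\lambda-3)n+4\lambda[\eta^2+(\lambda-1)^2].$$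
   Context: For $b=\lambda+i\eta$ with $\lambda>0$, $\eta\in\mathbb{R}$, the complementary Romanovski-Routh (CRR) polynomials are $\mathcal{P}_n(b;x)=\frac{(2\lambda)_n}{2^n(\lambda)_n}(x-i)^n\,{}_2F_1\!\left(-n,b;b+\overline{b};\frac{-2i}{x-i}\right)$, $n\ge0$, where $(\alpha)_n=\alpha(\alpha+1)\cdots(\alpha+n-1)$. Equivalently, $\mathcal{P}_0(b;x)=1$, $\mathcal{P}_1(b;x)=x-c_1^{(b)}$, and $\mathcal{P}_{n+1}(b;x)=(x-c_{n+1}^{(b)})\mathcal{P}_n(b;x)-d_{n+1}^{(\lambda)}(x^2+1)\mathcal{P}_{n-1}(b;x)$ for $n\ge1$, where $c_n^{(b)}=\frac{\eta}{\lambda+n-1}$ and $d_{n+1}^{(\lambda)}=\frac14\frac{n(n+2\lambda-1)}{(n+\lambda-1)(n+\lambda)}$, $n\ge1$. It is known that $\mathcal{P}_n(b;x)$ has $n$ real simple zeros. *)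

theory Defs
  imports "HOL-Analysis.Analysis"
begin

definition hyp2F1 :: "complex \<Rightarrow> complex \<Rightarrow> complex \<Rightarrow> complex \<Rightarrow> complex" where
  "hyp2F1 a b c z = eval_fps (fps_hypergeo [a, b] [c] 1) z"

(* The complementary Romanovski-Routh polynomial of degree n with parameter b, Re b > 0.
   The argument is real because the formula breaks down at x = i, where HOL's division by
   zero would not give the value of the polynomial. For real x the value is real, although
   the formula produces it as a complex number. *)
definition crr_poly :: "complex \<Rightarrow> nat \<Rightarrow> real \<Rightarrow> complex" where
  "crr_poly b n x =
     complex_of_real (pochhammer (2 * Re b) n / (2 ^ n * pochhammer (Re b) n))
     * (complex_of_real x - \<i>) ^ n
     * hyp2F1 (- of_nat n) b (b + cnj b) (- 2 * \<i> / (complex_of_real x - \<i>))"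

definition crr_Delta :: "real \<Rightarrow> real \<Rightarrow> real \<Rightarrow> real" where
  "crr_Delta \<eta> lam n =
     (\<eta>\<^sup>2 + lam * (lam + 2)) * n\<^sup>2 + 2 * lam * (\<eta>\<^sup>2 + lam\<^sup>2 + 2 * lam - 3) * n
     + 4 * lam * (\<eta>\<^sup>2 + (lam - 1)\<^sup>2)"

end

theory Submission
  imports Defs
begin

text \<open>
  Let \<open>P\<close> be the polynomial of degree \<open>n\<close>. The bounds come from combining two facts at a zero \<open>r\<close>:
  \<open>P\<close> has only real zeros, and \<open>P\<close> solves the differential equation
  \<open>(t\<^sup>2 + 1) P'' - 2 ((n + lam - 1) t - \<eta>) P' + n (n - 1 + 2 lam) P = 0\<close>.
  Let \<open>S1\<close> and \<open>S2\<close> be the sums of \<open>1 / (r - t)\<close> and of its square over the other zeros \<open>t\<close>. At \<open>r\<close>,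
  the quotients \<open>P'' / P'\<close> and \<open>P''' / P'\<close> are \<open>2 S1\<close> and \<open>3 (S1\<^sup>2 - S2)\<close>
  (\<open>derivatives_at_linear_factor\<close>, \<open>log_derivatives_prod_linear_factors\<close>), so the equation and its
  derivative determine \<open>S1\<close> and \<open>S2\<close> as functions of \<open>r\<close> alone (\<open>crr_zero_log_derivatives\<close>).
  As the zeros are real and distinct, the Cauchy-Schwarz inequality \<open>S1\<^sup>2 < (n - 1) S2\<close> is strict;
  this is Laguerre's inequality for \<open>P / (t - r)\<close>.

  Inserting the values of \<open>S1\<close> and \<open>S2\<close> turns it into a quadratic inequality for \<open>r\<close>
  (\<open>crr_zero_quadratic_bound\<close>). The claimed bounds are the two roots of this quadratic, and as the
  inequality holds at every zero, it holds at the smallest and at the largest one.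

  The hypergeometric formula is an expansion in powers of \<open>u = t - \<i>\<close>. The proof stays with the
  complex polynomial in \<open>u\<close>: its zeros are the real zeros translated by \<open>-\<i>\<close>, so differences of
  zeros remain real, and only these enter \<open>S1\<close> and \<open>S2\<close>.
\<close>

section \<open>Logarithmic derivatives of products of linear factors\<close>

text \<open>
  The gap is the number of terms times the sum of the squared deviations from the mean, and distinct
  values cannot all equal their mean.
\<close>
lemma strict_cauchy_schwarz_sum:
  fixes y :: "'a \<Rightarrow> real"
  assumes "finite J" "inj_on y J" "card J \<ge> 2"
  shows "(\<Sum>l\<in>J. y l)\<^sup>2 < real (card J) * (\<Sum>l\<in>J. (y l)\<^sup>2)"
proof -
  define m where "m = real (card J)"
  define S where "S = (\<Sum>l\<in>J. y l)"
  have m: "m > 0" using assms(3) by (simp add: m_def)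
  have expand: "(\<Sum>l\<in>J. (y l - c)\<^sup>2) = (\<Sum>l\<in>J. (y l)\<^sup>2) - 2 * c * S + m * c\<^sup>2" for c
    by (simp add: power2_diff sum.distrib sum_subtractf S_def m_def
        flip: sum_distrib_left sum_distrib_right)
  have "\<exists>l\<in>J. y l \<noteq> S / m"
  proof (rule ccontr)
    assume "\<not> ?thesis"
    then have "y ` J \<subseteq> {S / m}" by auto
    then have "card (y ` J) \<le> 1" using card_mono[of "{S / m}" "y ` J"] by simp
    then show False using assms card_image[of y J] by simp
  qed
  then obtain l where "l \<in> J" "y l \<noteq> S / m" by blast
  then have "0 < (\<Sum>l\<in>J. (y l - S / m)\<^sup>2)"
    using assms(1) by (intro sum_pos2[of J l]) auto
  also have "\<dots> = (\<Sum>l\<in>J. (y l)\<^sup>2) - 2 * (S / m) * S + m * (S / m)\<^sup>2"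
    by (rule expand)
  also have "\<dots> = (\<Sum>l\<in>J. (y l)\<^sup>2) - S\<^sup>2 / m"
    using m by (simp add: field_simps power2_eq_square)
  finally show ?thesis
    using m by (simp add: field_simps S_def m_def)
qed

lemma prod_linear_factors_dvd:
  fixes p :: "'a::field poly"
  assumes "finite A" "\<And>a. a \<in> A \<Longrightarrow> poly p a = 0"
  shows "(\<Prod>a\<in>A. [:- a, 1:]) dvd p"
  using assms
proof (induction A rule: finite_induct)
  case (insert a A)
  then obtain s where s: "p = (\<Prod>a\<in>A. [:- a, 1:]) * s" by (auto elim: dvdE)
  have "poly (\<Prod>a\<in>A. [:- a, 1:]) a \<noteq> 0"
    using insert.hyps by (auto simp: poly_prod)
  moreover have "poly p a = 0" using insert.prems by simp
  ultimately have "[:- a, 1:] dvd s" by (simp add: s poly_eq_0_iff_dvd[symmetric])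
  then show ?case
    unfolding s prod.insert[OF insert.hyps] by (metis dvd_refl mult.commute mult_dvd_mono)
qed simp

lemma degree_le_card_factorization:
  fixes p :: "'a::field poly"
  assumes "finite A" "\<And>a. a \<in> A \<Longrightarrow> poly p a = 0" "degree p \<le> card A" "p \<noteq> 0"
  obtains c where "c \<noteq> 0" "p = smult c (\<Prod>a\<in>A. [:- a, 1:])"
proof -
  obtain s where s: "p = (\<Prod>a\<in>A. [:- a, 1:]) * s"
    using prod_linear_factors_dvd[of A p] assms(1,2) by (auto elim: dvdE)
  have nz: "s \<noteq> 0" "(\<Prod>a\<in>A. [:- a, 1:]) \<noteq> 0" using s assms(4) by auto
  have "degree (\<Prod>a\<in>A. [:- a, 1:]) = card A"
    by (subst degree_prod_eq_sum_degree) auto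
  then have "degree s = 0"
    using assms(3) degree_mult_eq[OF nz(2) nz(1)] s by simp
  then obtain c where "s = [:c:]" by (rule degree_eq_zeroE)
  then show ?thesis using that[of c] nz s by simp
qed

lemma pderiv_linear_factor_mult:
  fixes p :: "'a::idom poly"
  shows "pderiv ([:- r, 1:] * p) = p + [:- r, 1:] * pderiv p"
  by (simp only: pderiv_mult) (simp add: pderiv_pCons)

text \<open>
  The second formula is \<open>s'' / s = (s' / s)\<^sup>2 + (s' / s)'\<close> with the first one inserted for \<open>s' / s\<close>.
\<close>
lemma log_derivatives_prod_linear_factors:
  fixes r :: "'a::field"
  assumes "finite A" "r \<notin> A"
  defines "s \<equiv> (\<Prod>a\<in>A. [:- a, 1:])"
  shows "poly (pderiv s) r = poly s r * (\<Sum>a\<in>A. 1 / (r - a))"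
    and "poly (pderiv (pderiv s)) r
          = poly s r * ((\<Sum>a\<in>A. 1 / (r - a))\<^sup>2 - (\<Sum>a\<in>A. (1 / (r - a))\<^sup>2))"
proof -
  have "poly (pderiv s) r = poly s r * (\<Sum>a\<in>A. 1 / (r - a)) \<and>
    poly (pderiv (pderiv s)) r
          = poly s r * ((\<Sum>a\<in>A. 1 / (r - a))\<^sup>2 - (\<Sum>a\<in>A. (1 / (r - a))\<^sup>2))"
    using assms(1,2) unfolding s_def
  proof (induction A rule: finite_induct)
    case (insert a A)
    define p where "p = (\<Prod>a\<in>A. [:- a, 1:])"
    define T1 T2 where "T1 = (\<Sum>a\<in>A. 1 / (r - a))" and "T2 = (\<Sum>a\<in>A. (1 / (r - a))\<^sup>2)"
    define d where "d = r - a"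
    have d: "d \<noteq> 0" using insert.prems by (auto simp: d_def)
    have IH: "poly (pderiv p) r = poly p r * T1"
      "poly (pderiv (pderiv p)) r = poly p r * (T1\<^sup>2 - T2)"
      using insert.IH insert.prems by (simp_all add: p_def T1_def T2_def)
    have ders: "poly ([:- a, 1:] * p) r = d * poly p r"
      "poly (pderiv ([:- a, 1:] * p)) r = poly p r + d * poly (pderiv p) r"
      "poly (pderiv (pderiv ([:- a, 1:] * p))) r
         = 2 * poly (pderiv p) r + d * poly (pderiv (pderiv p)) r"
      unfolding pderiv_linear_factor_mult pderiv_add by (simp_all add: d_def algebra_simps)
    show ?case
      unfolding prod.insert[OF insert.hyps] sum.insert[OF insert.hyps]
        p_def[symmetric] T1_def[symmetric] T2_def[symmetric] d_def[symmetric] ders IH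
      using d by (simp add: field_simps power2_eq_square)
  qed simp
  then show "poly (pderiv s) r = poly s r * (\<Sum>a\<in>A. 1 / (r - a))"
    "poly (pderiv (pderiv s)) r
          = poly s r * ((\<Sum>a\<in>A. 1 / (r - a))\<^sup>2 - (\<Sum>a\<in>A. (1 / (r - a))\<^sup>2))" by auto
qed

text \<open>
  Leibniz' rule at a zero of the linear factor: only the terms that differentiate this factor
  exactly once survive.
\<close>
lemma derivatives_at_linear_factor:
  fixes r :: "'a::idom" and s :: "'a poly"
  defines "p \<equiv> [:- r, 1:] * s"
  shows "poly (pderiv p) r = poly s r"
    and "poly (pderiv (pderiv p)) r = 2 * poly (pderiv s) r"
    and "poly (pderiv (pderiv (pderiv p))) r = 3 * poly (pderiv (pderiv s)) r"
  unfolding p_def pderiv_linear_factor_mult pderiv_add by simp_all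

section \<open>The differential equation of the CRR polynomials\<close>

text \<open>
  The \<open>k\<close>-th term of the hypergeometric series contributes the power \<open>u ^ (n - k)\<close> of
  \<open>u = t - \<i>\<close>, since \<open>u ^ n\<close> stands in front of a series in \<open>-2\<i> / u\<close>.
\<close>
definition crr_coeff :: "complex \<Rightarrow> nat \<Rightarrow> nat \<Rightarrow> complex" where
  "crr_coeff b n k = pochhammer (- of_nat n) k * pochhammer b k
     / (pochhammer (b + cnj b) k * fact k) * (- 2 * \<i>) ^ k"

text \<open>
  The CRR polynomial as a polynomial in \<open>t - \<i>\<close>, up to a normalising factor that is positive for
  \<open>Re b > 0\<close>.
\<close>
definition crr_shifted :: "complex \<Rightarrow> nat \<Rightarrow> complex poly" where
  "crr_shifted b n = (\<Sum>m\<le>n. monom (crr_coeff b n (n - m)) m)"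

lemma coeff_crr_shifted:
  "coeff (crr_shifted b n) m = (if m \<le> n then crr_coeff b n (n - m) else 0)"
  by (simp add: crr_shifted_def coeff_sum coeff_monom if_distrib cong: if_cong)

lemma degree_crr_shifted: "degree (crr_shifted b n) \<le> n"
  by (rule degree_le) (simp add: coeff_crr_shifted)

lemma crr_poly_eq_poly:
  "crr_poly b n t = complex_of_real (pochhammer (2 * Re b) n / (2 ^ n * pochhammer (Re b) n))
     * poly (crr_shifted b n) (of_real t - \<i>)"
proof -
  define u where "u = complex_of_real t - \<i>"
  have u: "u \<noteq> 0" by (auto simp: u_def complex_eq_iff)
  have "hyp2F1 (- of_nat n) b (b + cnj b) (- 2 * \<i> / u)
      = (\<Sum>k. pochhammer (- of_nat n) k * pochhammer b k
     / (pochhammer (b + cnj b) k * fact k) * (- 2 * \<i> / u) ^ k)"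
    by (simp add: hyp2F1_def eval_fps_def)
  also have "\<dots> = (\<Sum>k\<le>n. pochhammer (- of_nat n) k * pochhammer b k
     / (pochhammer (b + cnj b) k * fact k) * (- 2 * \<i> / u) ^ k)"
    by (intro suminf_finite) (auto simp: pochhammer_of_nat_eq_0_iff)
  also have "u ^ n * \<dots> = (\<Sum>k\<le>n. crr_coeff b n k * u ^ (n - k))"
    unfolding sum_distrib_left
  proof (intro sum.cong refl)
    fix k assume "k \<in> {..n}"
    then have split: "u ^ n = u ^ k * u ^ (n - k)" by (simp add: power_add[symmetric])
    then show "u ^ n * (pochhammer (- of_nat n) k * pochhammer b k
     / (pochhammer (b + cnj b) k * fact k) * (- 2 * \<i> / u) ^ k) = crr_coeff b n k * u ^ (n - k)"
      unfolding crr_coeff_def power_divide split using u by simp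
  qed
  also have "\<dots> = (\<Sum>m\<le>n. crr_coeff b n (n - m) * u ^ m)"
    using sum.atLeastAtMost_rev[of "\<lambda>k. crr_coeff b n k * u ^ (n - k)" 0 n]
    by (simp add: atLeast0AtMost)
  also have "\<dots> = poly (crr_shifted b n) u"
    by (simp add: crr_shifted_def poly_sum poly_monom)
  finally show ?thesis by (simp add: crr_poly_def u_def mult.assoc)
qed

lemma crr_coeff_Suc:
  assumes "Re b > 0"
  shows "of_nat (Suc k) * (2 * of_real (Re b) + of_nat k) * crr_coeff b n (Suc k)
     = 2 * \<i> * (of_nat n - of_nat k) * (b + of_nat k) * crr_coeff b n k"
proof -
  have bb: "b + cnj b = of_real (2 * Re b)" by (simp add: complex_eq_iff)
  have "pochhammer (b + cnj b) j \<noteq> 0" for j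
    using assms pochhammer_pos[of "2 * Re b" j] unfolding bb pochhammer_of_real by simp
  from this[of "Suc k"] have nz: "pochhammer (b + cnj b) k \<noteq> 0" "b + cnj b + of_nat k \<noteq> 0"
    by (auto simp: pochhammer_Suc)
  define D where "D = b + cnj b + of_nat k"
  have D: "2 * of_real (Re b) + of_nat k = D" using bb by (simp add: D_def)
  have "crr_coeff b n (Suc k) = crr_coeff b n k * ((of_nat k - of_nat n) * (b + of_nat k)
     * (- 2 * \<i>) / (D * of_nat (Suc k)))"
    unfolding crr_coeff_def pochhammer_Suc D_def by (simp add: mult_ac)
  then show ?thesis
    using nz unfolding D D_def[symmetric]
    by (simp add: divide_simps del: of_nat_Suc) (simp add: algebra_simps)
qed

text \<open>
  In powers of \<open>u = t - \<i>\<close> the factor \<open>t\<^sup>2 + 1\<close> becomes \<open>u (u + 2\<i>)\<close>. As this has no constant term,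
  the equation says no more than a two-term recurrence between neighbouring coefficients, which is
  the recurrence of the hypergeometric series.
\<close>
lemma crr_shifted_ode:
  fixes lam \<eta> :: real and n :: nat
  assumes b: "b = Complex lam \<eta>" and lam: "lam > 0"
  defines "q \<equiv> crr_shifted b n" and "N \<equiv> of_nat n + complex_of_real lam - 1"
  shows "[:0, 2 * \<i>, 1:] * pderiv (pderiv q) - [:2 * (N * \<i> - of_real \<eta>), 2 * N:] * pderiv q
     + [:of_nat n * (of_nat n - 1 + 2 * of_real lam):] * q = 0" (is "?E = 0")
proof (rule poly_eqI)
  fix m
  have "coeff ?E m = (of_nat n - of_nat m) * (of_nat n - 1 + 2 * of_real lam - of_nat m) * coeff q m
      + 2 * of_nat (Suc m) * (\<i> * of_nat m - N * \<i> + of_real \<eta>) * coeff q (Suc m)"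
    by (cases m; cases "m - 1")
       (auto simp: coeff_pderiv N_def algebra_simps)
  also have "\<dots> = 0"
  proof (cases "m < n")
    case True
    define k where "k = n - Suc m"
    have k: "n = Suc m + k" "n - m = Suc k" using True by (auto simp: k_def)
    have bk: "b = of_real lam + \<i> * of_real \<eta>" using b by (simp add: complex_eq_iff)
    have i: "\<i> * of_nat m - N * \<i> + of_real \<eta> = - \<i> * (b + of_nat k)"
      by (simp add: N_def k(1) bk algebra_simps)
    show ?thesis
      using crr_coeff_Suc[of b k n] lam True k
      unfolding i by (simp add: q_def coeff_crr_shifted b k_def[symmetric] algebra_simps)
  next
    case False
    then show ?thesis by (cases "m = n") (simp_all add: q_def coeff_crr_shifted)
  qed
  finally show "coeff ?E m = coeff 0 m" by simp
qed

section \<open>The inequality at a zero\<close>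

text \<open>
  The two equations are the differential equation and its derivative at \<open>r\<close>, each divided by the
  first derivative of the polynomial at \<open>r\<close>.
\<close>
lemma crr_zero_log_derivatives:
  fixes X :: "real set" and r lam \<eta> :: real and n :: nat
  assumes b: "b = Complex lam \<eta>" and lam: "lam > 0"
    and X: "finite X" "card X = n" "\<And>t. t \<in> X \<Longrightarrow> crr_poly b n t = 0"
    and nz: "crr_shifted b n \<noteq> 0" and r: "r \<in> X"
  defines "S1 \<equiv> \<Sum>t\<in>X - {r}. 1 / (r - t)" and "S2 \<equiv> \<Sum>t\<in>X - {r}. (1 / (r - t))\<^sup>2"
    and "A \<equiv> (real n + lam - 1) * r - \<eta>"
  shows "(r\<^sup>2 + 1) * S1 = A"
    and "3 * (r\<^sup>2 + 1) * (S1\<^sup>2 - S2) = 4 * (A - r) * S1 - (real n - 1) * (real n - 2 + 2 * lam)"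
proof -
  define q where "q = crr_shifted b n"
  define f where "f = (\<lambda>t. complex_of_real t - \<i>)"
  have inj: "inj_on f B" for B by (auto simp: f_def inj_on_def)
  have "pochhammer (2 * lam) n \<noteq> 0" "pochhammer lam n \<noteq> 0"
    using lam pochhammer_pos[of "2 * lam" n] pochhammer_pos[of lam n] by auto
  then have root: "poly q (f t) = 0" if "t \<in> X" for t
    using X(3)[OF that] b by (simp add: crr_poly_eq_poly q_def f_def)
  obtain c where c: "c \<noteq> 0" "q = smult c (\<Prod>a\<in>f ` X. [:- a, 1:])"
  proof (rule degree_le_card_factorization[of "f ` X" q])
    show "degree q \<le> card (f ` X)"
      using degree_crr_shifted[of b n] by (simp add: q_def card_image[OF inj] X(2))
  qed (use X(1) root nz in \<open>auto simp: q_def\<close>)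
  define Y where "Y = f ` (X - {r})"
  have Y: "finite Y" "f r \<notin> Y" "f ` X = insert (f r) Y"
    using X(1) r by (auto simp: Y_def f_def)
  define p where "p = (\<Prod>a\<in>Y. [:- a, 1:])"
  have q: "q = [:- f r, 1:] * smult c p"
    using Y by (simp add: c(2) p_def)
  \<comment> \<open>This is the derivative of \<open>q\<close> at its simple zero \<open>f r\<close>.\<close>
  define \<sigma> where "\<sigma> = c * poly p (f r)"
  have \<sigma>: "\<sigma> \<noteq> 0" using c(1) Y by (auto simp: \<sigma>_def p_def poly_prod)
  have S: "(\<Sum>a\<in>Y. 1 / (f r - a)) = of_real S1" "(\<Sum>a\<in>Y. (1 / (f r - a))\<^sup>2) = of_real S2"
    by (simp_all add: Y_def sum.reindex[OF inj] S1_def S2_def, simp_all add: f_def)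
  have d: "poly (pderiv q) (f r) = \<sigma>"
    "poly (pderiv (pderiv q)) (f r) = \<sigma> * of_real (2 * S1)"
    "poly (pderiv (pderiv (pderiv q))) (f r) = \<sigma> * of_real (3 * (S1\<^sup>2 - S2))"
    using log_derivatives_prod_linear_factors[OF Y(1,2)]
    unfolding q derivatives_at_linear_factor
    by (simp_all add: pderiv_smult \<sigma>_def p_def[symmetric] S)
  define N where "N = complex_of_real (real n + lam - 1)"
  define K where "K = complex_of_real (real n * (real n - 1 + 2 * lam))"
  let ?E = "[:0, 2 * \<i>, 1:] * pderiv (pderiv q) - [:2 * (N * \<i> - of_real \<eta>), 2 * N:] * pderiv q + [:K:] * q"
  have E: "?E = 0"
    using crr_shifted_ode[OF b lam, of n] by (simp add: q_def N_def K_def)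
  \<comment> \<open>At the point \<open>f r = r - \<i>\<close> the coefficients of the differential equation are real.\<close>
  have fr: "f r * (f r + 2 * \<i>) = of_real (r\<^sup>2 + 1)" "f r + \<i> = of_real r"
    "N * of_real r - of_real \<eta> = of_real A"
    by (simp_all add: f_def A_def N_def algebra_simps power2_eq_square)
  have "poly ?E u = u * (u + 2 * \<i>) * poly (pderiv (pderiv q)) u
      - 2 * (N * (u + \<i>) - of_real \<eta>) * poly (pderiv q) u + K * poly q u" for u
    by (simp add: algebra_simps)
  from this[of "f r"] have "\<sigma> * of_real (2 * ((r\<^sup>2 + 1) * S1 - A)) = 0"
    unfolding E poly_0 fr root[OF r] d by (simp add: algebra_simps)
  then show S1: "(r\<^sup>2 + 1) * S1 = A"
    using \<sigma> unfolding mult_eq_0_iff of_real_eq_0_iff by simp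
  have "poly (pderiv ?E) u = u * (u + 2 * \<i>) * poly (pderiv (pderiv (pderiv q))) u
      + 2 * (u + \<i>) * poly (pderiv (pderiv q)) u
      - 2 * (N * (u + \<i>) - of_real \<eta>) * poly (pderiv (pderiv q)) u
      - 2 * N * poly (pderiv q) u + K * poly (pderiv q) u" for u
    unfolding pderiv_mult pderiv_add pderiv_diff by (simp add: pderiv_pCons algebra_simps)
  from this[of "f r"] have "\<sigma> * of_real (3 * (r\<^sup>2 + 1) * (S1\<^sup>2 - S2)
      - (4 * (A - r) * S1 - (real n - 1) * (real n - 2 + 2 * lam))) = 0"
    unfolding E poly_0 pderiv_0 fr d by (simp add: N_def K_def algebra_simps)
  then show "3 * (r\<^sup>2 + 1) * (S1\<^sup>2 - S2) = 4 * (A - r) * S1 - (real n - 1) * (real n - 2 + 2 * lam)"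
    using \<sigma> unfolding mult_eq_0_iff of_real_eq_0_iff by simp
qed

text \<open>
  Eliminating \<open>S1\<close> and \<open>S2\<close> from the strict Cauchy-Schwarz inequality, with \<open>N = n + lam - 1\<close>, gives a
  quadratic inequality whose leading coefficient
  \<open>(n + 2) N\<^sup>2 - 4 (n - 1) N - (n - 1)\<^sup>2 (n - 2 + 2 lam)\<close> equals \<open>L\<close>: the terms free of \<open>lam\<close> cancel,
  which leaves the factor \<open>lam\<close> and makes \<open>L\<close> positive. The conclusion is \<open>L r\<^sup>2 - 2 B r < C\<close> after
  completing the square, and \<open>B\<^sup>2 + L C\<close> is \<open>(n - 1)\<^sup>2\<close> times \<open>crr_Delta\<close>. Strictness takes two
  further zeros besides \<open>r\<close>, hence \<open>n \<ge> 3\<close>.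
\<close>
lemma crr_zero_quadratic_bound:
  fixes X :: "real set" and r lam \<eta> :: real and n :: nat
  assumes b: "b = Complex lam \<eta>" and lam: "lam > 0" and n: "n \<ge> 3"
    and X: "finite X" "card X = n" "\<And>t. t \<in> X \<Longrightarrow> crr_poly b n t = 0"
    and nz: "crr_shifted b n \<noteq> 0" and r: "r \<in> X"
  defines "L \<equiv> lam * (2 * (real n - 1) + (real n + 2) * lam)"
    and "B \<equiv> \<eta> * (real n ^ 2 + 2 * lam + real n * (lam - 1))"
  shows "(L * r - B)\<^sup>2 < (real n - 1)\<^sup>2 * crr_Delta \<eta> lam (real n)"
proof -
  define S1 where "S1 = (\<Sum>t\<in>X - {r}. 1 / (r - t))"
  define S2 where "S2 = (\<Sum>t\<in>X - {r}. (1 / (r - t))\<^sup>2)"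
  define A where "A = (real n + lam - 1) * r - \<eta>"
  define T where "T = r\<^sup>2 + 1"
  define G where "G = (real n - 1) * (real n - 2 + 2 * lam)"
  have T: "T > 0" by (simp add: T_def add_nonneg_pos)
  have card: "card (X - {r}) = n - 1" using X r by simp
  have "S1\<^sup>2 < real (card (X - {r})) * S2"
    unfolding S1_def S2_def
    by (rule strict_cauchy_schwarz_sum) (use X n card in \<open>auto simp: inj_on_def\<close>)
  then have "S1\<^sup>2 < (real n - 1) * S2" using n by (simp add: card of_nat_diff)
  then have CS: "3 * T\<^sup>2 * S1\<^sup>2 < 3 * T\<^sup>2 * ((real n - 1) * S2)"
    using T by simp
  have TS: "T * S1 = A" "3 * T * (S1\<^sup>2 - S2) = 4 * (A - r) * S1 - G"
    using crr_zero_log_derivatives[OF b lam X nz r]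
    by (simp_all add: S1_def S2_def A_def T_def G_def)
  have TS1: "T\<^sup>2 * S1\<^sup>2 = A\<^sup>2" using TS(1) by (simp flip: power_mult_distrib)
  have "3 * T\<^sup>2 * S2 = 3 * (T\<^sup>2 * S1\<^sup>2) - T * (3 * T * (S1\<^sup>2 - S2))"
    by (simp add: algebra_simps power2_eq_square)
  also have "\<dots> = 3 * A\<^sup>2 - 4 * (A - r) * (T * S1) + G * T"
    unfolding TS(2) TS1 by (simp add: algebra_simps)
  finally have S2: "3 * T\<^sup>2 * S2 = 3 * A\<^sup>2 - 4 * (A - r) * A + G * T" unfolding TS(1) .
  have "3 * A\<^sup>2 = 3 * T\<^sup>2 * S1\<^sup>2" using TS1 by simp
  also note CS
  also have "3 * T\<^sup>2 * ((real n - 1) * S2) = (real n - 1) * (3 * T\<^sup>2 * S2)" by simp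
  also note S2
  finally have "3 * A\<^sup>2 < (real n - 1) * (3 * A\<^sup>2 - 4 * (A - r) * A + G * T)" .
  then have Q: "0 < (real n - 1) * (3 * A\<^sup>2 - 4 * (A - r) * A + G * T) - 3 * A\<^sup>2" by simp
  \<comment> \<open>Multiplying by the leading coefficient \<open>L\<close> completes the square.\<close>
  have "L > 0" using lam n by (simp add: L_def add_pos_pos)
  then have "0 < L * ((real n - 1) * (3 * A\<^sup>2 - 4 * (A - r) * A + G * T) - 3 * A\<^sup>2)"
    using Q by simp
  also have "\<dots> = (real n - 1)\<^sup>2 * crr_Delta \<eta> lam (real n) - (L * r - B)\<^sup>2"
    unfolding L_def B_def A_def T_def G_def crr_Delta_def by algebra
  finally show ?thesis by simp
qed

theorem theorem3p1:
  fixes lam \<eta> :: real and b :: complex and n :: nat and x :: "nat \<Rightarrow> real"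
  assumes "lam > 0"
    and "b = Complex lam \<eta>"
    and "n \<ge> 4"
    and "strict_mono_on {1..n} x"
    and "{t. crr_poly b n t = 0} = x ` {1..n}"
  shows "(\<eta> * (real n ^ 2 + 2 * lam + real n * (lam - 1))
            - (real n - 1) * sqrt (crr_Delta \<eta> lam (real n)))
          / (lam * (2 * (real n - 1) + (real n + 2) * lam)) < x 1
       \<and> x 1 < x n
       \<and> x n < (\<eta> * (real n ^ 2 + 2 * lam + real n * (lam - 1))
            + (real n - 1) * sqrt (crr_Delta \<eta> lam (real n)))
          / (lam * (2 * (real n - 1) + (real n + 2) * lam))"
proof -
  define X where "X = x ` {1..n}"
  define L where "L = lam * (2 * (real n - 1) + (real n + 2) * lam)"
  define B where "B = \<eta> * (real n ^ 2 + 2 * lam + real n * (lam - 1))"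
  define R where "R = (real n - 1) * sqrt (crr_Delta \<eta> lam (real n))"
  have X: "finite X" "card X = n" "\<And>t. t \<in> X \<Longrightarrow> crr_poly b n t = 0"
    using assms(5) card_image[OF strict_mono_on_imp_inj_on[OF assms(4)]] by (auto simp: X_def)
  \<comment> \<open>The zero polynomial would vanish everywhere, but the zero set is finite.\<close>
  have nz: "crr_shifted b n \<noteq> 0"
  proof
    assume "crr_shifted b n = 0"
    then have "X = UNIV" using assms(5) by (auto simp: crr_poly_eq_poly X_def)
    then show False using X(1) infinite_UNIV_char_0[where 'a = real] by simp
  qed
  have L: "L > 0" using assms(1,3) by (simp add: L_def add_pos_pos)
  have bounds: "(B - R) / L < r \<and> r < (B + R) / L" if "r \<in> X" for r
  proof -
    have sq: "(L * r - B)\<^sup>2 < (real n - 1)\<^sup>2 * crr_Delta \<eta> lam (real n)"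
      using crr_zero_quadratic_bound[OF assms(2,1) _ X nz that] assms(3) by (simp add: L_def B_def)
    have "\<bar>L * r - B\<bar> < sqrt ((real n - 1)\<^sup>2 * crr_Delta \<eta> lam (real n))"
      using real_sqrt_less_mono[OF sq] by simp
    also have "\<dots> = R" using assms(3) by (simp add: R_def real_sqrt_mult)
    finally show ?thesis using L by (simp add: field_simps abs_less_iff)
  qed
  have "x 1 < x n" using assms(3) by (intro strict_mono_onD[OF assms(4)]) auto
  moreover have "x 1 \<in> X" "x n \<in> X" using assms(3) by (auto simp: X_def)
  ultimately show ?thesis
    using bounds unfolding L_def[symmetric] B_def[symmetric] R_def[symmetric] by blast
qed

end
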